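(* For $1 \le u \le v$, the digital image $\left(\prod_{i=1}^v [a_i,b_i]_{\mathbb{Z}},\, c_u\right)$ has the approximate fixed point property (AFPP) if and only if $u=v$.
   Context: A digital image $(X,\kappa)$ is a set $X$ of lattice points in some $\mathbb{Z}^n$ together with an adjacency relation $\kappa$ on $X$, i.e., a symmetric irreflexive relation. Write $x \leftrightarrow_\kappa y$ if $x,y$ are $\kappa$-adjacent. A subset $A\subset X$ is $\kappa$-connected if for all $a,b \in A$ there is a sequence $a=x_0,\dots,x_k=b$ in $A$ with $x_i \leftrightarrow_\kappa x_{i+1}$ or $x_i = x_{i+1}$ for $0\le i<k$. A function $f: X \to X$ is $\kappa$-continuous if it maps $\kappa$-connected subsets to $\kappa$-connected subsets (equivalently, $x \leftrightarrow_\kappa x'$ implies that $f(x) \leftrightarrow_\kappa f(x')$ or $f(x) = f(x')$). $(X,\kappa)$ has the AFPP if for every $\kappa$-continuous $f: X \to X$ there is a point $x\in X$ with $f(x) \leftrightarrow_\kappa x$ or $f(x) = x$. Here $u$ and $v$ are integers, and $a_i, b_i$ ($i=1,\dots,v$) are integers; for integers $a \le b$, $[a,b]_{\mathbb{Z}} = \{t \in \mathbb{Z} : a \le t \le b\}$ is a digital interval, so that $\prod_{i=1}^v [a_i,b_i]_{\mathbb{Z}} \subset \mathbb{Z}^v$. For $1 \le u \le n$, distinct points $x,y\in\mathbb{Z}^n$ are $c_u$-adjacent if there are at most $u$ indices $i$ with $|x_i-y_i|=1$, and $x_j=y_j$ for all indices $j$ with $|x_j-y_j|\ne 1$.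
   Formalization: When u < v every interval is assumed nondegenerate (a_i < b_i for all i), since otherwise the claim fails: a single point, or [0,1]×[0,0] with c_1, has the AFPP although u < v. For u = v degenerate intervals (a_i = b_i) are allowed. *)

theory Defs
  imports "HOL-Analysis.Finite_Cartesian_Product"
begin

type_synonym 'n adjacency = "int ^ 'n \<Rightarrow> int ^ 'n \<Rightarrow> bool"

definition digital_image :: "(int ^ 'n) set \<Rightarrow> 'n adjacency \<Rightarrow> bool" where
  "digital_image X \<kappa> \<longleftrightarrow>
     (\<forall>x\<in>X. \<not> \<kappa> x x) \<and> (\<forall>x\<in>X. \<forall>y\<in>X. \<kappa> x y \<longrightarrow> \<kappa> y x)"

definition adj_connected :: "'n adjacency \<Rightarrow> (int ^ 'n) set \<Rightarrow> bool" where
  "adj_connected \<kappa> A \<longleftrightarrow>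
     (\<forall>a\<in>A. \<forall>b\<in>A. \<exists>(k::nat) p. p 0 = a \<and> p k = b \<and> (\<forall>i\<le>k. p i \<in> A) \<and>
        (\<forall>i<k. \<kappa> (p i) (p (Suc i)) \<or> p i = p (Suc i)))"

definition digitally_continuous ::
  "(int ^ 'n) set \<Rightarrow> 'n adjacency \<Rightarrow> (int ^ 'n \<Rightarrow> int ^ 'n) \<Rightarrow> bool" where
  "digitally_continuous X \<kappa> f \<longleftrightarrow>
     (\<forall>A\<subseteq>X. adj_connected \<kappa> A \<longrightarrow> adj_connected \<kappa> (f ` A))"

(* A self-map of X is a total function f with f ` X a subset of X; its values
   outside X are irrelevant. *)
definition AFPP :: "(int ^ 'n) set \<Rightarrow> 'n adjacency \<Rightarrow> bool" where
  "AFPP X \<kappa> \<longleftrightarrow>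
     (\<forall>f. f ` X \<subseteq> X \<and> digitally_continuous X \<kappa> f \<longrightarrow>
        (\<exists>x\<in>X. \<kappa> (f x) x \<or> f x = x))"

definition c_adj :: "nat \<Rightarrow> 'n::finite adjacency" where
  "c_adj u x y \<longleftrightarrow> x \<noteq> y \<and>
     card {i. \<bar>x $ i - y $ i\<bar> = 1} \<le> u \<and>
     (\<forall>j. \<bar>x $ j - y $ j\<bar> \<noteq> 1 \<longrightarrow> x $ j = y $ j)"

(* Degenerate factors a i = b i are allowed here.  They matter for the AFPP: a
   one-point image, for instance, has the AFPP with respect to every adjacency. *)
definition digital_box :: "('n \<Rightarrow> int) \<Rightarrow> ('n \<Rightarrow> int) \<Rightarrow> (int ^ 'n) set" where
  "digital_box a b = {x. \<forall>i. x $ i \<in> {a i..b i}}"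

lemma digital_image_c_adj: "digital_image X (c_adj u)"
  by (auto simp: digital_image_def c_adj_def abs_minus_commute)

lemma digitally_continuous_iff:
  assumes "digital_image X \<kappa>"
  shows "digitally_continuous X \<kappa> f \<longleftrightarrow>
    (\<forall>x\<in>X. \<forall>y\<in>X. \<kappa> x y \<longrightarrow> \<kappa> (f x) (f y) \<or> f x = f y)"
proof
  assume L: "digitally_continuous X \<kappa> f"
  show "\<forall>x\<in>X. \<forall>y\<in>X. \<kappa> x y \<longrightarrow> \<kappa> (f x) (f y) \<or> f x = f y"
  proof (intro ballI impI)
    fix x y assume xy: "x \<in> X" "y \<in> X" "\<kappa> x y"
    then have yx: "\<kappa> y x" using assms by (auto simp: digital_image_def)
    have "adj_connected \<kappa> {x, y}"
      unfolding adj_connected_def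
    proof (intro ballI)
      fix a b assume "a \<in> {x, y}" "b \<in> {x, y}"
      then show "\<exists>(k::nat) p. p 0 = a \<and> p k = b \<and> (\<forall>i\<le>k. p i \<in> {x, y}) \<and>
        (\<forall>i<k. \<kappa> (p i) (p (Suc i)) \<or> p i = p (Suc i))"
        using xy yx
        by (intro exI[of _ 1] exI[of _ "\<lambda>i. if i = 0 then a else b"]) auto
    qed
    then have "adj_connected \<kappa> (f ` {x, y})"
      using L[unfolded digitally_continuous_def, rule_format, of "{x, y}"] xy by auto
    then obtain k :: nat and p where p: "p 0 = f x" "p k = f y"
      "\<forall>i\<le>k. p i \<in> f ` {x, y}"
      "\<forall>i<k. \<kappa> (p i) (p (Suc i)) \<or> p i = p (Suc i)"
      unfolding adj_connected_def[of _ "f ` {x, y}"]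
      by (elim ballE[where x = "f x"] ballE[where x = "f y"] exE conjE) auto
    show "\<kappa> (f x) (f y) \<or> f x = f y"
    proof (rule ccontr)
      assume n: "\<not> ?thesis"
      have "i \<le> k \<Longrightarrow> p i = f x" for i
      proof (induction i)
        case (Suc i)
        then have "p i = f x" "p (Suc i) \<in> {f x, f y}" using p(3)[rule_format, of "Suc i"] by simp_all
        moreover have "\<kappa> (p i) (p (Suc i)) \<or> p i = p (Suc i)" using p(4)[rule_format, of i] Suc.prems by simp
        ultimately show ?case using n by auto
      qed (use p in simp)
      from this[of k] show False using p(2) n by simp
    qed
  qed
next
  assume R: "\<forall>x\<in>X. \<forall>y\<in>X. \<kappa> x y \<longrightarrow> \<kappa> (f x) (f y) \<or> f x = f y"
  show "digitally_continuous X \<kappa> f"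
    unfolding digitally_continuous_def
  proof (intro allI impI)
    fix A assume A: "A \<subseteq> X" "adj_connected \<kappa> A"
    show "adj_connected \<kappa> (f ` A)"
      unfolding adj_connected_def
    proof (intro ballI)
      fix a' b' assume "a' \<in> f ` A" "b' \<in> f ` A"
      then obtain a b where ab: "a \<in> A" "b \<in> A" "a' = f a" "b' = f b" by auto
      then obtain k :: nat and p where p: "p 0 = a" "p k = b" "\<forall>i\<le>k. p i \<in> A"
        "\<forall>i<k. \<kappa> (p i) (p (Suc i)) \<or> p i = p (Suc i)"
        using A(2)[unfolded adj_connected_def, rule_format, OF ab(1,2)] by auto
      have "\<kappa> (f (p i)) (f (p (Suc i))) \<or> f (p i) = f (p (Suc i))" if "i < k" for i
      proof -
        have "p i \<in> X" "p (Suc i) \<in> X" using p(3) A(1) that by auto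
        then show ?thesis using R p(4)[rule_format, OF that] by auto
      qed
      then show "\<exists>(k::nat) p. p 0 = a' \<and> p k = b' \<and> (\<forall>i\<le>k. p i \<in> f ` A) \<and>
        (\<forall>i<k. \<kappa> (p i) (p (Suc i)) \<or> p i = p (Suc i))"
        using p ab by (intro exI[of _ k] exI[of _ "f \<circ> p"]) (simp add: image_iff, blast)
    qed
  qed
qed

end

theory Submission
  imports Defs "HOL-Analysis.Brouwer_Fixpoint"
begin

text \<open>
  With \<open>u\<close> equal to the dimension, being equal or adjacent means having sup-distance at most 1.
  The claim is then a discrete Brouwer theorem, and it follows from the combinatorial lemma behind
  the Brouwer theorem. Label a lattice point, in each coordinate, by whether the map
  moves it strictly downwards in that coordinate. Kuhn's lemma (\<open>kuhn_lemma\<close>) gives a unit cube on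
  which both labels occur in every coordinate. Since the map is 1-Lipschitz, the lowest
  corner of that cube is moved by at most 1 in every coordinate
  (\<open>box_self_map_has_near_fixed_point\<close>).

  With \<open>u\<close> smaller than the dimension, collapse the box onto the unit cube at its lower corner
  and follow this by the antipodal map of that cube (\<open>collapse_antipode\<close>). The composite acts on
  each coordinate separately and so never increases the number of coordinates in which two points
  differ. Moreover two values of one of its coordinates differ by at most 1, so it is
  continuous. Yet it changes every coordinate of every point, which is more than \<open>u\<close>
  coordinates, so no point is adjacent or equal to its image.
\<close>

lemma c_adj_full_or_eq_iff:
  fixes x y :: "int ^ 'v::finite"
  shows "c_adj CARD('v) x y \<or> x = y \<longleftrightarrow> (\<forall>i. \<bar>x $ i - y $ i\<bar> \<le> 1)"
proof -
  have "card {i. \<bar>x $ i - y $ i\<bar> = 1} \<le> CARD('v)"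
    by (rule card_mono) auto
  moreover have "(\<bar>x $ i - y $ i\<bar> \<noteq> 1 \<longrightarrow> x $ i = y $ i) \<longleftrightarrow> \<bar>x $ i - y $ i\<bar> \<le> 1" for i
    by linarith
  ultimately show ?thesis
    by (auto simp: c_adj_def)
qed

text \<open>
  Kuhn's lemma speaks of a cube with the same side in all directions. The map is therefore
  carried over to a cube that is larger than the box, by first projecting the cube onto the box
  coordinatewise. The projection is 1-Lipschitz, and projecting a point never takes it farther
  from any point of the box. So if a point of the cube is within 1 of its image, which lies in
  the box, then so is its projection, which has the same image.
\<close>

lemma box_self_map_has_near_fixed_point:
  fixes f :: "int ^ 'v::finite \<Rightarrow> int ^ 'v" and a b :: "'v \<Rightarrow> int"
  assumes nonempty: "\<And>i. a i \<le> b i"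
    and self_map: "\<And>x. x \<in> digital_box a b \<Longrightarrow> f x \<in> digital_box a b"
    and lipschitz: "\<And>x y i. \<lbrakk>x \<in> digital_box a b; y \<in> digital_box a b;
        \<And>j. \<bar>x $ j - y $ j\<bar> \<le> 1\<rbrakk> \<Longrightarrow> \<bar>f x $ i - f y $ i\<bar> \<le> 1"
  obtains x where "x \<in> digital_box a b" "\<And>i. \<bar>f x $ i - x $ i\<bar> \<le> 1"
proof -
  define n where "n = CARD('v)"
  obtain e where e: "bij_betw e {0..<n} (UNIV :: 'v set)"
    using ex_bij_betw_nat_finite[of "UNIV :: 'v set"] by (auto simp: n_def)
  define h where "h = inv_into {0..<n} e"
  have h: "h i < n" "e (h i) = i" for i
  proof -
    have "i \<in> e ` {0..<n}" using e by (auto simp: bij_betw_def)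
    from inv_into_into[OF this] f_inv_into_f[OF this]
    show "h i < n" "e (h i) = i" by (auto simp: h_def)
  qed
  \<comment> \<open>The side strictly exceeds every side of the box: on an upper face of the cube the projected
    map then moves points strictly downwards, as the boundary condition of Kuhn's lemma demands.\<close>
  define p :: nat where "p = Suc (\<Sum>i\<in>UNIV. nat (b i - a i))"
  have p: "b i - a i < int p" for i
  proof -
    have "nat (b i - a i) \<le> (\<Sum>i\<in>UNIV. nat (b i - a i))"
      by (rule member_le_sum) auto
    then show ?thesis unfolding p_def by linarith
  qed
  define proj :: "(nat \<Rightarrow> nat) \<Rightarrow> int ^ 'v"
    where "proj z = (\<chi> i. min (b i) (a i + int (z (h i))))" for z
  have proj_box: "proj z \<in> digital_box a b" for z
    using nonempty by (auto simp: proj_def digital_box_def)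
  define F where "F z i = f (proj z) $ i - a i" for z i
  have F_range: "0 \<le> F z i" "F z i < int p" for z i
    using self_map[OF proj_box[of z]] p[of i] by (auto simp: F_def digital_box_def) (smt (verit))
  have F_lipschitz: "\<bar>F y i - F z i\<bar> \<le> 1"
    if "\<And>j. j < n \<Longrightarrow> \<bar>int (y j) - int (z j)\<bar> \<le> 1" for y z i
  proof -
    have "\<bar>proj y $ j - proj z $ j\<bar> \<le> 1" for j
      using that[OF h(1)[of j]] by (simp add: proj_def)
    from lipschitz[OF proj_box proj_box this] show ?thesis by (simp add: F_def)
  qed
  define label :: "(nat \<Rightarrow> nat) \<Rightarrow> nat \<Rightarrow> nat"
    where "label z j = (if int (z j) \<le> F z (e j) then 0 else 1)" for z j
  have label_top: "label z j = 1" if "z j = p" for z j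
    using F_range(2)[of z "e j"] that by (simp add: label_def)
  obtain q where q: "\<forall>j<n. \<exists>r s. (\<forall>k<n. q k \<le> r k \<and> r k \<le> q k + 1) \<and>
      (\<forall>k<n. q k \<le> s k \<and> s k \<le> q k + 1) \<and> label r j \<noteq> label s j"
  proof (rule kuhn_lemma[of p n label])
    show "0 < p" by (simp add: p_def)
    show "\<forall>x. (\<forall>i<n. x i \<le> p) \<longrightarrow> (\<forall>i<n. label x i = 0 \<or> label x i = 1)"
      by (simp add: label_def)
    show "\<forall>x. (\<forall>i<n. x i \<le> p) \<longrightarrow> (\<forall>i<n. x i = 0 \<longrightarrow> label x i = 0)"
      by (simp add: label_def F_range)
    show "\<forall>x. (\<forall>i<n. x i \<le> p) \<longrightarrow> (\<forall>i<n. x i = p \<longrightarrow> label x i = 1)"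
      by (simp add: label_top)
  qed blast
  have near: "\<bar>F q i - int (q (h i))\<bar> \<le> 1" for i
  proof -
    obtain r s where rs: "\<forall>k<n. q k \<le> r k \<and> r k \<le> q k + 1"
        "\<forall>k<n. q k \<le> s k \<and> s k \<le> q k + 1" "label r (h i) = 0" "label s (h i) \<noteq> 0"
    proof -
      obtain r s where "\<forall>k<n. q k \<le> r k \<and> r k \<le> q k + 1"
        "\<forall>k<n. q k \<le> s k \<and> s k \<le> q k + 1" "label r (h i) \<noteq> label s (h i)"
        using q h(1) by blast
      then show thesis
        using that[of r s] that[of s r] by (cases "label r (h i) = 0") (auto simp: label_def split: if_splits)
    qed
    \<comment> \<open>The corner \<open>s\<close> may lie one above \<open>q\<close>, but it is moved strictly downwards. This strictness
      is what bounds the upward displacement of \<open>q\<close> by 1 instead of 2.\<close>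
    have "\<bar>F q i - F r i\<bar> \<le> 1" "\<bar>F q i - F s i\<bar> \<le> 1"
      using rs(1,2) by (force intro!: F_lipschitz)+
    moreover have "int (r (h i)) \<le> F r i" "F s i < int (s (h i))"
      using rs(3,4) by (auto simp: label_def h(2) split: if_splits)
    moreover have "q (h i) \<le> r (h i)" "s (h i) \<le> q (h i) + 1"
      using rs(1,2) h(1) by blast+
    ultimately show ?thesis by linarith
  qed
  have "\<bar>f (proj q) $ i - proj q $ i\<bar> \<le> 1" for i
  proof -
    have "f (proj q) $ i \<le> b i"
      using self_map[OF proj_box[of q]] by (simp add: digital_box_def)
    then show ?thesis
      using near[of i] by (simp add: proj_def F_def min_def) linarith
  qed
  then show thesis by (rule that[OF proj_box])
qed

definition collapse_antipode :: "('v::finite \<Rightarrow> int) \<Rightarrow> int ^ 'v \<Rightarrow> int ^ 'v" where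
  "collapse_antipode a x = (\<chi> i. if x $ i = a i then a i + 1 else a i)"

lemma collapse_antipode_continuous:
  assumes "c_adj u x y"
  shows "c_adj u (collapse_antipode a x) (collapse_antipode a y) \<or>
    collapse_antipode a x = collapse_antipode a y"
proof -
  let ?g = "collapse_antipode a"
  have differ: "x $ i \<noteq> y $ i \<Longrightarrow> \<bar>x $ i - y $ i\<bar> = 1" for i
    using assms by (auto simp: c_adj_def)
  have "{i. \<bar>?g x $ i - ?g y $ i\<bar> = 1} \<subseteq> {i. \<bar>x $ i - y $ i\<bar> = 1}"
    using differ by (force simp: collapse_antipode_def)
  then have "card {i. \<bar>?g x $ i - ?g y $ i\<bar> = 1} \<le> card {i. \<bar>x $ i - y $ i\<bar> = 1}"
    by (rule card_mono[rotated]) simp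
  also have "\<dots> \<le> u" using assms by (simp add: c_adj_def)
  finally show ?thesis
    by (auto simp: c_adj_def collapse_antipode_def)
qed

lemma c_adj_agree_somewhere:
  fixes x y :: "int ^ 'v::finite"
  assumes "c_adj u x y" "u < CARD('v)"
  obtains i where "x $ i = y $ i"
proof -
  have "{i. \<bar>x $ i - y $ i\<bar> = 1} \<noteq> UNIV"
    using assms by (auto simp: c_adj_def)
  then show thesis
    using assms(1) that by (auto simp: c_adj_def)
qed

theorem theorem4p11:
  fixes a b :: "'v::finite \<Rightarrow> int" and u :: nat
  assumes "1 \<le> u" and "u \<le> CARD('v)"
    and "\<And>i. a i \<le> b i"
    and nondegenerate: "\<And>i. u < CARD('v) \<Longrightarrow> a i < b i"
  shows "AFPP (digital_box a b) (c_adj u) \<longleftrightarrow> u = CARD('v)"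
proof
  assume afpp: "AFPP (digital_box a b) (c_adj u)"
  show "u = CARD('v)"
  proof (rule ccontr)
    assume "u \<noteq> CARD('v)"
    then have u: "u < CARD('v)" using assms(2) by simp
    let ?g = "collapse_antipode a"
    have "?g ` digital_box a b \<subseteq> digital_box a b"
      using nondegenerate[OF u] assms(3)
      by (auto simp: collapse_antipode_def digital_box_def add1_zle_eq)
    moreover have "digitally_continuous (digital_box a b) (c_adj u) ?g"
      by (simp add: digitally_continuous_iff digital_image_c_adj collapse_antipode_continuous)
    ultimately obtain x where x: "c_adj u (?g x) x \<or> ?g x = x"
      using afpp unfolding AFPP_def by blast
    then obtain i where "?g x $ i = x $ i"
      using c_adj_agree_somewhere[OF _ u] by metis
    then show False
      by (simp add: collapse_antipode_def split: if_splits)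
  qed
next
  assume u: "u = CARD('v)"
  show "AFPP (digital_box a b) (c_adj u)"
    unfolding AFPP_def
  proof (intro allI impI, elim conjE)
    fix f assume self: "f ` digital_box a b \<subseteq> digital_box a b"
      and "digitally_continuous (digital_box a b) (c_adj u) f"
    then have cont: "c_adj u (f x) (f y) \<or> f x = f y"
      if "x \<in> digital_box a b" "y \<in> digital_box a b" "c_adj u x y" for x y
      using that by (simp add: digitally_continuous_iff digital_image_c_adj)
    have lip: "\<bar>f x $ i - f y $ i\<bar> \<le> 1"
      if "x \<in> digital_box a b" "y \<in> digital_box a b" "\<And>j. \<bar>x $ j - y $ j\<bar> \<le> 1" for x y i
      using cont[OF that(1,2)] that(3) c_adj_full_or_eq_iff[of x y]
        c_adj_full_or_eq_iff[of "f x" "f y"] unfolding u by blast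
    obtain x where "x \<in> digital_box a b" "\<And>i. \<bar>f x $ i - x $ i\<bar> \<le> 1"
      by (rule box_self_map_has_near_fixed_point[of a b f]) (use assms(3) self lip in auto)
    then show "\<exists>x\<in>digital_box a b. c_adj u (f x) x \<or> f x = x"
      unfolding u c_adj_full_or_eq_iff by blast
  qed
qed

end
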